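(* Let $G$ be any finite connected simple graph. Then $G$ admits an integral flow $M$-basis. That is, there exists a $\mathbb{Z}$-basis $\mathcal{B} = \{\mathbf{f}_1, \dots, \mathbf{f}_g\}$ for its lattice of integral flows $\mathcal{F}(G)$ such that the associated dual Laplacian $\mathcal{L}^*$ is an $M$-matrix.
   Context: Let $G=(V,E)$ be a finite connected undirected simple graph with a fixed orientation of its edges, and let $\partial : \mathbb{R}^E \to \mathbb{R}^V$ be the signed incidence matrix: the column of an edge has an entry $-1$ in the row of one endpoint and $+1$ in the row of the other endpoint (according to the orientation), and $0$ elsewhere. The lattice of integral flows of $G$ is $\mathcal{F}(G) = \mathbb{Z}^E \cap \ker(\partial)$, a free abelian group of rank $g = |E|-|V|+1$. Given a $\mathbb{Z}$-basis $\mathcal{B} = \{\mathbf{f}_1,\dots,\mathbf{f}_g\}$ of $\mathcal{F}(G)$, let $\iota$ be the $|E|\times g$ matrix with columns $\mathbf{f}_1,\dots,\mathbf{f}_g$; the associated dual Laplacian is $\mathcal{L}^* = \iota^T\iota$. An $n\times n$ matrix $L$ is a $Z$-matrix if $L_{ij}\le 0$ for all $i\ne j$. A $Z$-matrix $L$ is a (non-singular) $M$-matrix if all eigenvalues of $L$ have positive real part (equivalently, $L^{-1}$ exists and has all entries non-negative). $\mathcal{B}$ is an integral flow $M$-basis if $\mathcal{L}^*$ is an $M$-matrix. *)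

theory Defs
  imports
    Complex_Main
    "Graph_Theory.Graph_Theory"
    "Jordan_Normal_Form.Char_Poly"
    "Jordan_Normal_Form.Matrix_Kernel"
begin

text \<open>
  A finite simple undirected graph is a \<^locale>\<open>pair_graph\<close>: it contains both arcs
  \<open>(u, v)\<close> and \<open>(v, u)\<close> for every undirected edge \<open>{u, v}\<close>. An orientation picks exactly
  one of the two, so that its elements stand for the undirected edges.
\<close>

definition orientation :: "'v pair_pre_digraph \<Rightarrow> ('v \<times> 'v) set \<Rightarrow> bool" where
  "orientation G A \<longleftrightarrow>
     A \<subseteq> parcs G \<and> (\<forall>u v. (u, v) \<in> parcs G \<longrightarrow> ((u, v) \<in> A) \<noteq> ((v, u) \<in> A))"

text \<open>
  Vectors and matrices are indexed by natural numbers. Below, \<open>vs\<close> enumerates the vertices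
  and \<open>es\<close> enumerates the oriented edges, so that \<open>\<int>\<^sup>E\<close> is \<open>carrier_vec (length es)\<close>.
\<close>

definition incidence_mat :: "'v list \<Rightarrow> ('v \<times> 'v) list \<Rightarrow> real mat" where
  "incidence_mat vs es = Matrix.mat (length vs) (length es)
     (\<lambda>(i, j). if vs ! i = fst (es ! j) then - 1 else if vs ! i = snd (es ! j) then 1 else 0)"

definition flow_lattice :: "'v list \<Rightarrow> ('v \<times> 'v) list \<Rightarrow> int vec set" where
  "flow_lattice vs es =
     {f \<in> carrier_vec (length es). map_vec real_of_int f \<in> mat_kernel (incidence_mat vs es)}"

definition Z_basis :: "nat \<Rightarrow> int vec set \<Rightarrow> int vec list \<Rightarrow> bool" where
  "Z_basis m L fs \<longleftrightarrow>
     set fs \<subseteq> carrier_vec m \<and> distinct fs \<and>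
     \<not> LinearCombinations.module.lin_dep class_ring (module_vec TYPE(int) m) (set fs) \<and>
     LinearCombinations.module.span class_ring (module_vec TYPE(int) m) (set fs) = L"

definition dual_laplacian :: "nat \<Rightarrow> int vec list \<Rightarrow> real mat" where
  "dual_laplacian m fs =
     (let \<iota> = map_mat real_of_int (mat_of_cols m fs) in transpose_mat \<iota> * \<iota>)"

definition Z_matrix :: "nat \<Rightarrow> real mat \<Rightarrow> bool" where
  "Z_matrix n L \<longleftrightarrow>
     L \<in> carrier_mat n n \<and> (\<forall>i<n. \<forall>j<n. i \<noteq> j \<longrightarrow> L $$ (i, j) \<le> 0)"

definition M_matrix :: "nat \<Rightarrow> real mat \<Rightarrow> bool" where
  "M_matrix n L \<longleftrightarrow>
     Z_matrix n L \<and> (\<forall>k. eigenvalue (map_mat complex_of_real L) k \<longrightarrow> Re k > 0)"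

definition integral_flow_M_basis :: "'v list \<Rightarrow> ('v \<times> 'v) list \<Rightarrow> int vec list \<Rightarrow> bool" where
  "integral_flow_M_basis vs es fs \<longleftrightarrow>
     Z_basis (length es) (flow_lattice vs es) fs \<and>
     M_matrix (length fs) (dual_laplacian (length es) fs)"

end

theory Submission
  imports Defs
begin

text \<open>
  Every lattice has an obtuse basis, that is, one with nonpositive pairwise inner products. Suppose
  that \<open>f\<^sub>1, \<dots>, f\<^sub>k\<close> is an obtuse basis of a primitive sublattice and that \<open>b\<close> extends it. The Gram
  matrix of the \<open>f\<^sub>i\<close> is invertible over the rationals, so some \<open>w\<close> in their integral span has
  \<open>f\<^sub>i \<bullet> w \<ge> 1\<close> for all \<open>i\<close>, and \<open>b - t w\<close> extends the basis obtusely once \<open>t\<close> is large. The Gram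
  matrix of an obtuse basis is a positive definite Z-matrix, hence an M-matrix. The rank of the
  lattice of flows is found by adding the edges one at a time: an edge either closes a cycle or
  joins two components.
\<close>


section \<open>Z-bases and their integer Gram matrices\<close>

definition gram :: "nat \<Rightarrow> int vec list \<Rightarrow> int mat" where
  "gram m fs = transpose_mat (mat_of_cols m fs) * mat_of_cols m fs"

lemma gram_carrier: "gram m fs \<in> carrier_mat (length fs) (length fs)"
  by (intro carrier_matI) (simp_all add: gram_def)

lemma gram_index:
  assumes "set fs \<subseteq> carrier_vec m" "i < length fs" "j < length fs"
  shows "gram m fs $$ (i, j) = fs ! i \<bullet> fs ! j"
  using assms by (simp add: gram_def subset_iff)

text \<open>In a vanishing combination the \<open>b\<close>-part is the negative of a vector of
  \<open>L\<close>, so \<open>indep\<close> kills its coefficient, and what is left is a relation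
  among \<open>fs\<close>.\<close>

lemma Z_basis_append:
  assumes basis: "Z_basis m L fs" and b: "b \<in> carrier_vec m"
    and indep: "\<And>a. a \<cdot>\<^sub>v b \<in> L \<Longrightarrow> a = 0"
  shows "Z_basis m {v + a \<cdot>\<^sub>v b | v a. v \<in> L} (fs @ [b])"
proof -
  interpret vec_module "TYPE(int)" m .
  have fs: "set fs \<subseteq> carrier_vec m" and dist: "distinct fs"
    and li: "lin_indpt (set fs)" and span: "span (set fs) = L"
    using basis by (auto simp: Z_basis_def)
  have L: "L = {lincomb a (set fs) | a. True}"
    using finite_span[of "set fs"] fs span by simp
  have bfs: "b \<notin> set fs"
  proof
    assume "b \<in> set fs"
    then have "1 \<cdot>\<^sub>v b \<in> L" using in_own_span[OF fs] span by auto
    then show False using indep by fastforce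
  qed
  have ins: "lincomb a (insert b (set fs)) = lincomb a (set fs) + a b \<cdot>\<^sub>v b" for a
  proof -
    have "lincomb a (insert b (set fs)) = a b \<cdot>\<^sub>v b + lincomb a (set fs)"
      by (rule lincomb_insert2) (use fs b bfs in auto)
    also have "\<dots> = lincomb a (set fs) + a b \<cdot>\<^sub>v b"
      by (rule comm_add_vec) (use fs b in auto)
    finally show ?thesis .
  qed
  have c: "lincomb a (set fs) \<in> carrier_vec m" for a using fs by auto
  have "lin_indpt (insert b (set fs))"
  proof (rule finite_lin_indpt2)
    fix a assume "lincomb a (insert b (set fs)) = 0\<^sub>v m"
    then have *: "lincomb a (set fs) + a b \<cdot>\<^sub>v b = 0\<^sub>v m" by (simp add: ins)
    have "- a b \<cdot>\<^sub>v b = lincomb a (set fs)"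
    proof (rule eq_vecI)
      fix i assume "i < dim_vec (lincomb a (set fs))"
      then have i: "i < m" using c by (metis carrier_vecD)
      have "(lincomb a (set fs) + a b \<cdot>\<^sub>v b) $ i = 0" using * i by simp
      then show "(- a b \<cdot>\<^sub>v b) $ i = lincomb a (set fs) $ i" using i b c[of a] by simp
    qed (use b c in \<open>metis carrier_vecD index_smult_vec(2)\<close>)
    then have "a b = 0" using indep[of "- a b"] L by auto
    then have "lincomb a (set fs) = 0\<^sub>v m" using * b c[of a] by auto
    then have "\<forall>v\<in>set fs. a v = 0"
      using li unfolding lin_dep_def by blast
    with \<open>a b = 0\<close> show "\<forall>v\<in>insert b (set fs). a v = 0" by simp
  qed (use fs b in auto)
  moreover have "span (insert b (set fs)) = {v + a \<cdot>\<^sub>v b | v a. v \<in> L}"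
  proof -
    have "span (insert b (set fs)) = {lincomb a (insert b (set fs)) | a. True}"
      using finite_span[of "insert b (set fs)"] fs b by simp
    also have "\<dots> = {v + a \<cdot>\<^sub>v b | v a. v \<in> L}"
    proof (intro equalityI subsetI)
      fix x assume "x \<in> {v + a \<cdot>\<^sub>v b | v a. v \<in> L}"
      then obtain a t where x: "x = lincomb a (set fs) + t \<cdot>\<^sub>v b" by (auto simp: L)
      \<comment> \<open>Since \<open>b\<close> is not in \<open>set fs\<close>, its coefficient can
        be reset without disturbing the part over \<open>fs\<close>.\<close>
      have "lincomb (a(b := t)) (set fs) = lincomb a (set fs)"
        by (rule lincomb_cong) (use fs bfs in auto)
      then have "x = lincomb (a(b := t)) (insert b (set fs))" by (simp add: x ins)
      then show "x \<in> {lincomb a (insert b (set fs)) | a. True}" by blast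
    qed (auto simp: ins L)
    finally show ?thesis .
  qed
  ultimately show ?thesis using fs b dist bfs by (simp add: Z_basis_def)
qed

lemma Z_basis_mat_kernel:
  assumes "Z_basis m L fs" "c \<in> carrier_vec (length fs)" "mat_of_cols m fs *\<^sub>v c = 0\<^sub>v m"
  shows "c = 0\<^sub>v (length fs)"
proof -
  interpret vec_module "TYPE(int)" m .
  have fs: "set fs \<subseteq> carrier_vec m" and dist: "distinct fs"
    and li: "lin_indpt (set fs)"
    using assms by (auto simp: Z_basis_def)
  \<comment> \<open>Linear independence attaches coefficients to vectors, the matrix product
    attaches them to positions. Distinctness of \<open>fs\<close> lets \<open>c\<close> pass from
    one to the other.\<close>
  define f where "f x = c $ (the_inv_into {..<length fs} ((!) fs) x)" for x
  have f: "f (fs ! i) = c $ i" if "i < length fs" for i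
    unfolding f_def using that dist by (subst the_inv_into_f_f) (auto simp: inj_on_nth)
  have "lincomb f (set fs) = mat_of_cols m fs *\<^sub>v vec (length fs) (\<lambda>i. f (fs ! i))"
    using fs dist by (subst lincomb_as_lincomb_list_distinct)
      (auto intro!: lincomb_list_as_mat_mult)
  also have "vec (length fs) (\<lambda>i. f (fs ! i)) = c"
    using assms(2) f by (intro eq_vecI) auto
  finally have "lincomb f (set fs) = 0\<^sub>v m" using assms(3) by simp
  then have "\<forall>v\<in>set fs. f v = 0" using li unfolding lin_dep_def by blast
  then show ?thesis using f assms(2) by (intro eq_vecI) auto
qed

text \<open>If \<open>c\<close> is in the kernel of the Gram matrix and \<open>B\<close> has the
  columns \<open>fs\<close>, then the squared norm of \<open>B *\<^sub>v c\<close> is the product of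
  \<open>gram m fs *\<^sub>v c\<close> with \<open>c\<close>, hence zero. So
  \<open>B *\<^sub>v c\<close> vanishes, and independence forces \<open>c\<close> to vanish.\<close>

lemma Z_basis_det_gram:
  assumes "Z_basis m L fs"
  shows "det (gram m fs) \<noteq> 0"
proof
  let ?B = "mat_of_cols m fs"
  assume "det (gram m fs) = 0"
  then obtain c where c: "c \<in> carrier_vec (length fs)" "c \<noteq> 0\<^sub>v (length fs)"
    "gram m fs *\<^sub>v c = 0\<^sub>v (length fs)"
    using det_0_iff_vec_prod_zero[OF gram_carrier] by blast
  have B: "?B \<in> carrier_mat m (length fs)" by simp
  have "(?B *\<^sub>v c) \<bullet> (?B *\<^sub>v c) = (transpose_mat ?B *\<^sub>v (?B *\<^sub>v c)) \<bullet> c"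
    using transpose_vec_mult_scalar[OF B c(1), of "?B *\<^sub>v c"]
      mult_mat_vec_carrier[OF B c(1)] by argo
  also have "transpose_mat ?B *\<^sub>v (?B *\<^sub>v c) = gram m fs *\<^sub>v c"
    unfolding gram_def using c(1)
    by (subst assoc_mult_mat_vec[of _ "length fs" m _ "length fs"]) auto
  finally have "(?B *\<^sub>v c) \<bullet> (?B *\<^sub>v c) = 0" using c by simp
  moreover have "conjugate (?B *\<^sub>v c) = ?B *\<^sub>v c" by (intro eq_vecI) (auto simp: conjugate_int_def)
  ultimately have "?B *\<^sub>v c = 0\<^sub>v m"
    using conjugate_square_eq_0_vec[OF mult_mat_vec_carrier[OF B c(1)]] by argo
  with Z_basis_mat_kernel[OF assms c(1)] c(2) show False by simp
qed

text \<open>The adjugate solves \<open>gram m fs *\<^sub>v k = d\<^sup>2\<close> over the integers, where \<open>d\<close> is the determinant.\<close>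

lemma Z_basis_positive_vector:
  assumes "Z_basis m L fs"
  obtains w where "w \<in> L" "\<And>f. f \<in> set fs \<Longrightarrow> 1 \<le> f \<bullet> w"
proof -
  interpret vec_module "TYPE(int)" m .
  let ?B = "mat_of_cols m fs" and ?n = "length fs" and ?d = "det (gram m fs)"
  have fs: "set fs \<subseteq> carrier_vec m" and dist: "distinct fs" and span: "span (set fs) = L"
    using assms by (auto simp: Z_basis_def)
  \<comment> \<open>The right-hand side has entries \<open>?d\<close> rather than 1: the adjugate
    contributes another factor \<open>?d\<close>, and the square of a nonzero integer is at least 1
    whatever its sign.\<close>
  define k where "k = adj_mat (gram m fs) *\<^sub>v vec ?n (\<lambda>_. ?d)"
  note adj = adj_mat[OF gram_carrier[of m fs]]
  have k: "k \<in> carrier_vec ?n" using adj(1) by (auto simp: k_def)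
  have "gram m fs *\<^sub>v k = (gram m fs * adj_mat (gram m fs)) *\<^sub>v vec ?n (\<lambda>_. ?d)"
    unfolding k_def by (rule assoc_mult_mat_vec[OF gram_carrier adj(1), symmetric]) simp
  also have "\<dots> = vec ?n (\<lambda>_. ?d * ?d)"
    unfolding adj(2) by (intro eq_vecI) (auto simp: scalar_prod_def if_distrib if_distribR cong: if_cong)
  finally have gk: "gram m fs *\<^sub>v k = vec ?n (\<lambda>_. ?d * ?d)" .
  have gk': "gram m fs *\<^sub>v k = transpose_mat ?B *\<^sub>v (?B *\<^sub>v k)"
    unfolding gram_def using k
    by (subst assoc_mult_mat_vec[of _ ?n m _ ?n]) auto
  have "?B *\<^sub>v k = lincomb_list (\<lambda>i. k $ i) fs"
    using fs k by (subst lincomb_list_as_mat_mult) (auto intro!: arg_cong[of _ _ "\<lambda>v. ?B *\<^sub>v v"])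
  then have "?B *\<^sub>v k \<in> L"
    using lincomb_list_as_lincomb[of fs "\<lambda>i. k $ i"] fs span finite_span[of "set fs"] by auto
  moreover have "1 \<le> f \<bullet> (?B *\<^sub>v k)" if f: "f \<in> set fs" for f
  proof -
    obtain i where i: "i < ?n" "f = fs ! i" using f by (metis in_set_conv_nth)
    have "f \<bullet> (?B *\<^sub>v k) = (transpose_mat ?B *\<^sub>v (?B *\<^sub>v k)) $ i"
      using i fs by (simp add: subset_iff)
    also have "\<dots> = ?d * ?d" using gk gk' i by simp
    also have "\<dots> \<ge> 1" using Z_basis_det_gram[OF assms]
      by (simp add: int_one_le_iff_zero_less flip: power2_eq_square)
    finally show ?thesis .
  qed
  ultimately show ?thesis using that by blast
qed


section \<open>Eigenvalues of the Gram matrix of an obtuse basis\<close>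

text \<open>Obtuseness gives the signs off the diagonal. For an eigenvector \<open>v\<close> with
  eigenvalue \<open>k\<close>, the squared norm of \<open>C *\<^sub>v v\<close> is \<open>k\<close>
  times that of \<open>v\<close>, so \<open>k\<close> is real and nonnegative; the nonzero Gram
  determinant rules out \<open>k = 0\<close>.\<close>

lemma Z_basis_imp_M_matrix:
  assumes basis: "Z_basis m L fs"
    and obtuse: "\<And>f g. f \<in> set fs \<Longrightarrow> g \<in> set fs \<Longrightarrow> f \<noteq> g \<Longrightarrow> f \<bullet> g \<le> 0"
  shows "M_matrix (length fs) (dual_laplacian m fs)"
proof -
  let ?n = "length fs" and ?B = "mat_of_cols m fs"
  have fs: "set fs \<subseteq> carrier_vec m" and dist: "distinct fs"
    using basis by (auto simp: Z_basis_def)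
  have lap: "dual_laplacian m fs = map_mat real_of_int (gram m fs)"
    unfolding dual_laplacian_def gram_def Let_def
    by (subst of_int_hom.mat_hom_mult[of _ ?n m _ ?n]) (simp_all add: map_mat_transpose)
  have "Z_matrix ?n (dual_laplacian m fs)"
    unfolding Z_matrix_def lap
  proof (intro conjI allI impI)
    show "map_mat real_of_int (gram m fs) \<in> carrier_mat ?n ?n"
      using gram_carrier[of m fs] by simp
    fix i j assume "i < ?n" "j < ?n" "i \<noteq> j"
    moreover from this have "fs ! i \<bullet> fs ! j \<le> 0"
      using dist by (intro obtuse) (auto simp: nth_eq_iff_index_eq)
    ultimately show "map_mat real_of_int (gram m fs) $$ (i, j) \<le> 0"
      using gram_carrier[of m fs] gram_index[OF fs] by auto
  qed
  moreover have "Re k > 0" if ev: "eigenvalue (map_mat complex_of_real (dual_laplacian m fs)) k" for k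
  proof -
    define C :: "complex mat" where "C = map_mat of_int ?B"
    have C: "C \<in> carrier_mat m ?n" by (simp add: C_def)
    have A: "map_mat complex_of_real (dual_laplacian m fs) = map_mat of_int (gram m fs)"
      unfolding lap by (intro eq_matI) auto
    also have "\<dots> = transpose_mat C * C"
      unfolding gram_def C_def
      by (subst of_int_hom.mat_hom_mult[of _ ?n m _ ?n]) (simp_all add: map_mat_transpose)
    finally have A': "map_mat complex_of_real (dual_laplacian m fs) = transpose_mat C * C" .
    obtain v where v: "v \<in> carrier_vec ?n" "v \<noteq> 0\<^sub>v ?n"
      "(transpose_mat C * C) *\<^sub>v v = k \<cdot>\<^sub>v v"
      using ev C unfolding A' eigenvalue_def eigenvector_def by auto
    have Cv: "C *\<^sub>v v \<in> carrier_vec m" using C v(1) by simp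
    \<comment> \<open>\<open>C\<close> has integer entries, so conjugation passes through it and its
      transpose acts as its adjoint.\<close>
    have conj: "conjugate (C *\<^sub>v v) = C *\<^sub>v conjugate v"
      using v(1) by (intro eq_vecI) (auto simp: C_def scalar_prod_def)
    have "transpose_mat C *\<^sub>v (C *\<^sub>v v) = k \<cdot>\<^sub>v v"
      using v(3) C v(1) by (subst assoc_mult_mat_vec[symmetric, of _ ?n m _ ?n]) auto
    then have "k * (v \<bullet>c v) = (transpose_mat C *\<^sub>v (C *\<^sub>v v)) \<bullet>c v"
      using v(1) by simp
    also have "\<dots> = (C *\<^sub>v v) \<bullet>c (C *\<^sub>v v)"
      unfolding conj using C v(1) Cv by (intro transpose_vec_mult_scalar) auto
    finally have eq: "k * (v \<bullet>c v) = (C *\<^sub>v v) \<bullet>c (C *\<^sub>v v)" .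
    have pos: "v \<bullet>c v > 0" using v by simp
    have nonneg: "(C *\<^sub>v v) \<bullet>c (C *\<^sub>v v) \<ge> 0" by (rule conjugate_square_ge_0_vec)
    have "k \<noteq> 0"
    proof
      assume "k = 0"
      then have "det (map_mat complex_of_real (dual_laplacian m fs)) = 0"
        using v(1,2) C unfolding A'
        by (subst det_0_iff_vec_prod_zero[of _ ?n])
          (auto simp del: assoc_mult_mat_vec simp: v(3) intro!: exI[of _ v])
      then show False unfolding A using Z_basis_det_gram[OF basis] by simp
    qed
    \<comment> \<open>The order on complex numbers compares real parts and demands equal imaginary
      parts, so these inequalities also say that the norms are real.\<close>
    have im: "Im (v \<bullet>c v) = 0" and re: "Re (v \<bullet>c v) > 0" using pos by (auto simp: less_complex_def)
    have "Re k * Re (v \<bullet>c v) \<ge> 0" "Im k * Re (v \<bullet>c v) = 0"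
      using nonneg im unfolding eq[symmetric] by (auto simp: less_eq_complex_def)
    then have "Re k \<ge> 0" "Im k = 0" using re by (auto simp: zero_le_mult_iff)
    with \<open>k \<noteq> 0\<close> show ?thesis by (auto simp: complex_eq_iff)
  qed
  ultimately show ?thesis by (simp add: M_matrix_def)
qed

section \<open>Obtuse bases of arbitrary sublattices\<close>

text \<open>The dimensions at which the flag of coordinate subspaces meets \<open>L\<close> in larger rank, so
  that their number is the rank of \<open>L\<close>.\<close>

definition pivots :: "nat \<Rightarrow> int vec set \<Rightarrow> nat set" where
  "pivots m L = {j. j < m \<and> (\<exists>v\<in>L. v $ j \<noteq> 0 \<and> (\<forall>i. j < i \<and> i < m \<longrightarrow> v $ i = 0))}"

text \<open>Induction along the flag \<open>T k\<close> of vectors of \<open>L\<close> supported on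
  the first \<open>k\<close> coordinates. At a pivot, a vector \<open>v\<close> with least nonzero
  absolute value at coordinate \<open>k\<close> extends a basis of \<open>T k\<close> to one of
  \<open>T (Suc k)\<close>. Adding to \<open>v\<close> an element of \<open>T k\<close> keeps this
  property and can make the extension obtuse.\<close>

lemma ex_obtuse_Z_basis:
  fixes L :: "int vec set"
  assumes carrier: "L \<subseteq> carrier_vec m" and zero: "0\<^sub>v m \<in> L"
    and add: "\<And>u v. u \<in> L \<Longrightarrow> v \<in> L \<Longrightarrow> u + v \<in> L"
    and smult: "\<And>a v. v \<in> L \<Longrightarrow> a \<cdot>\<^sub>v v \<in> L"
  shows "\<exists>fs. Z_basis m L fs \<and> (\<forall>f\<in>set fs. \<forall>g\<in>set fs. f \<noteq> g \<longrightarrow> f \<bullet> g \<le> 0) \<and>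
    length fs = card (pivots m L)"
proof -
  define P where "P = pivots m L"
  define T where "T k = {v \<in> L. \<forall>i. k \<le> i \<and> i < m \<longrightarrow> v $ i = 0}" for k
  have "\<exists>fs. Z_basis m (T k) fs \<and> (\<forall>f\<in>set fs. \<forall>g\<in>set fs. f \<noteq> g \<longrightarrow> f \<bullet> g \<le> 0) \<and>
      length fs = card {j. j < k \<and> j \<in> P}" if "k \<le> m" for k
    using that
  proof (induction k)
    case 0
    interpret vec_module "TYPE(int)" m .
    have "T 0 = {0\<^sub>v m}"
      using zero carrier by (auto simp: T_def intro!: eq_vecI dest: carrier_vecD)
    then have "Z_basis m (T 0) []"
      using finite_lin_indpt2[of "{}"] finite_span[of "{}"] by (simp add: Z_basis_def)
    then show ?case by (intro exI[of _ "[]"]) simp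
  next
    case (Suc k)
    then obtain fs where fs: "Z_basis m (T k) fs"
      "\<forall>f\<in>set fs. \<forall>g\<in>set fs. f \<noteq> g \<longrightarrow> f \<bullet> g \<le> 0"
      "length fs = card {j. j < k \<and> j \<in> P}" by (meson Suc_leD)
    have km: "k < m" using Suc.prems by simp
    have T_Suc: "v \<in> T k \<longleftrightarrow> v \<in> T (Suc k) \<and> v $ k = 0" for v
    proof -
      have "k \<le> i \<longleftrightarrow> i = k \<or> Suc k \<le> i" for i by auto
      then show ?thesis using km by (auto simp: T_def)
    qed
    have T_carrier: "T j \<subseteq> carrier_vec m" for j using carrier by (auto simp: T_def)
    have T_add: "u + v \<in> T j" if "u \<in> T j" "v \<in> T j" for u v j
    proof -
      have "v \<in> carrier_vec m" using that T_carrier by blast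
      then show ?thesis using that add[of u v] by (simp add: T_def)
    qed
    have T_smult: "a \<cdot>\<^sub>v v \<in> T j" if "v \<in> T j" for a v j
    proof -
      have "v \<in> carrier_vec m" using that T_carrier by blast
      then show ?thesis using that smult[of v a] by (simp add: T_def)
    qed
    show ?case
    proof (cases "k \<in> P")
      case False
      then have "T (Suc k) = T k" using T_Suc km unfolding P_def pivots_def T_def Suc_le_eq by blast
      moreover have "{j. j < Suc k \<and> j \<in> P} = {j. j < k \<and> j \<in> P}"
        using False by (auto simp: less_Suc_eq)
      ultimately show ?thesis using fs by metis
    next
      case True
      then obtain v0 where "v0 \<in> T (Suc k)" "v0 $ k \<noteq> 0"
        using km unfolding P_def pivots_def T_def Suc_le_eq by blast
      then obtain v where v: "v \<in> T (Suc k)" "v $ k \<noteq> 0"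
        and least: "\<And>u. u \<in> T (Suc k) \<Longrightarrow> u $ k \<noteq> 0 \<Longrightarrow> nat \<bar>v $ k\<bar> \<le> nat \<bar>u $ k\<bar>"
        using ex_has_least_nat[of "\<lambda>u. u \<in> T (Suc k) \<and> u $ k \<noteq> 0" v0 "\<lambda>u. nat \<bar>u $ k\<bar>"]
        by blast
      have dvd: "v $ k dvd u $ k" if u: "u \<in> T (Suc k)" for u
      proof (rule ccontr)
        assume "\<not> v $ k dvd u $ k"
        \<comment> \<open>Division with remainder: a coordinate not divisible by
          \<open>v $ k\<close> would leave a vector of \<open>T (Suc k)\<close> with a smaller
          nonzero \<open>k\<close>-th coordinate, against minimality.\<close>
        define r where "r = u + (- (u $ k div v $ k)) \<cdot>\<^sub>v v"
        have "r \<in> T (Suc k)" unfolding r_def using u v by (intro T_add T_smult)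
        moreover have rk: "r $ k = u $ k mod v $ k"
        proof -
          have "v \<in> carrier_vec m" "u \<in> carrier_vec m" using u v T_carrier by blast+
          then have "r $ k = u $ k - u $ k div v $ k * v $ k" using km by (simp add: r_def)
          then show ?thesis by (simp only: minus_div_mult_eq_mod)
        qed
        moreover have "r $ k \<noteq> 0" using \<open>\<not> v $ k dvd u $ k\<close> rk by (simp add: dvd_eq_mod_eq_0)
        ultimately have "nat \<bar>v $ k\<bar> \<le> nat \<bar>u $ k mod v $ k\<bar>" using least by metis
        then show False using abs_mod_less[OF v(2), of "u $ k"] by linarith
      qed
      obtain w where w: "w \<in> T k" "\<And>f. f \<in> set fs \<Longrightarrow> 1 \<le> f \<bullet> w"
        using Z_basis_positive_vector[OF fs(1)] by blast
      \<comment> \<open>\<open>t\<close> bounds every \<open>f \<bullet> v\<close>, and every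
        \<open>f \<bullet> w\<close> is at least 1, so subtracting \<open>t\<close> copies of
        \<open>w\<close> from \<open>v\<close> makes all products with \<open>fs\<close>
        nonpositive.\<close>
      define t where "t = (\<Sum>f\<in>set fs. \<bar>f \<bullet> v\<bar>)"
      define b where "b = v + (- t) \<cdot>\<^sub>v w"
      have wc: "w \<in> carrier_vec m" and vc: "v \<in> carrier_vec m" using w v T_carrier by auto
      have bT: "b \<in> T (Suc k)" unfolding b_def using v w T_Suc by (intro T_add T_smult) auto
      have bc: "b \<in> carrier_vec m" using bT T_carrier by auto
      \<comment> \<open>The correction lies in \<open>T k\<close> and vanishes at \<open>k\<close>,
        so \<open>b $ k\<close> still divides the \<open>k\<close>-th coordinate of every vector of
        \<open>T (Suc k)\<close>.\<close>
      have bk: "b $ k = v $ k" using w(1) T_Suc[of w] km wc by (simp add: b_def)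
      have fsc: "set fs \<subseteq> carrier_vec m" using fs(1) by (simp add: Z_basis_def)
      have fb: "f \<bullet> b \<le> 0" if f: "f \<in> set fs" for f
      proof -
        have "f \<bullet> b = f \<bullet> v - t * (f \<bullet> w)"
          unfolding b_def using f fsc wc vc by (subst scalar_prod_add_distrib[of _ m]) auto
        moreover have "f \<bullet> v \<le> t"
          unfolding t_def using member_le_sum[of f "set fs" "\<lambda>f. \<bar>f \<bullet> v\<bar>"] f by simp
        moreover have "t * 1 \<le> t * (f \<bullet> w)"
          using w(2)[OF f] by (intro mult_left_mono) (auto simp: t_def sum_nonneg)
        ultimately show ?thesis by simp
      qed
      have bf: "b \<bullet> f \<le> 0" if f: "f \<in> set fs" for f
        using fb[OF f] comm_scalar_prod[of b m f] f fsc bc by auto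
      have "Z_basis m {u + a \<cdot>\<^sub>v b | u a. u \<in> T k} (fs @ [b])"
      proof (rule Z_basis_append[OF fs(1) bc])
        fix a assume "a \<cdot>\<^sub>v b \<in> T k"
        then have "a * b $ k = 0" using T_Suc[of "a \<cdot>\<^sub>v b"] km bc by simp
        then show "a = 0" using bk v(2) by simp
      qed
      moreover have "{u + a \<cdot>\<^sub>v b | u a. u \<in> T k} = T (Suc k)"
      proof (intro equalityI subsetI)
        fix x assume "x \<in> {u + a \<cdot>\<^sub>v b | u a. u \<in> T k}"
        then show "x \<in> T (Suc k)" using T_Suc bT by (auto intro!: T_add T_smult)
      next
        fix x assume x: "x \<in> T (Suc k)"
        then obtain a where a: "x $ k = a * b $ k" using dvd[OF x] bk by (metis dvd_def mult.commute)
        have xc: "x \<in> carrier_vec m" using x T_carrier by auto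
        have "x + (- a) \<cdot>\<^sub>v b \<in> T k"
          unfolding T_Suc using a x bT km bc by (auto intro!: T_add T_smult)
        moreover have "x = (x + (- a) \<cdot>\<^sub>v b) + a \<cdot>\<^sub>v b"
          using xc bc by (intro eq_vecI) auto
        ultimately show "x \<in> {u + a \<cdot>\<^sub>v b | u a. u \<in> T k}" by blast
      qed
      moreover have "{j. j < Suc k \<and> j \<in> P} = insert k {j. j < k \<and> j \<in> P}"
        using True by (auto simp: less_Suc_eq)
      ultimately show ?thesis
        using fs(2,3) fb bf by (intro exI[of _ "fs @ [b]"]) auto
    qed
  qed
  moreover have "T m = L" by (auto simp: T_def)
  moreover have "{j. j < m \<and> j \<in> P} = P" by (auto simp: P_def pivots_def)
  ultimately show ?thesis unfolding P_def by (metis order_refl)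
qed


section \<open>Flows as chains with vanishing boundary\<close>

text \<open>The integral incidence map, indexed by vertices themselves rather than by positions in
  \<open>vs\<close>, so that paths and cuts can be treated without an enumeration of the
  vertices.\<close>

definition boundary :: "('v \<times> 'v) list \<Rightarrow> int vec \<Rightarrow> 'v \<Rightarrow> int" where
  "boundary es f x =
     (\<Sum>j<length es. f $ j * (of_bool (x = snd (es ! j)) - of_bool (x = fst (es ! j))))"

lemma boundary_zero: "boundary es (0\<^sub>v (length es)) x = 0"
  by (simp add: boundary_def)

lemma boundary_add:
  "u \<in> carrier_vec (length es) \<Longrightarrow> v \<in> carrier_vec (length es) \<Longrightarrow>
    boundary es (u + v) x = boundary es u x + boundary es v x"
  by (auto simp: boundary_def algebra_simps sum.distrib simp flip: sum.distrib intro!: sum.cong)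

lemma boundary_smult:
  "v \<in> carrier_vec (length es) \<Longrightarrow> boundary es (a \<cdot>\<^sub>v v) x = a * boundary es v x"
  by (auto simp: boundary_def sum_distrib_left intro!: sum.cong)

lemma boundary_unit:
  assumes "k < length es"
  shows "boundary es (unit_vec (length es) k) x =
    of_bool (x = snd (es ! k)) - of_bool (x = fst (es ! k))"
proof -
  have "boundary es (unit_vec (length es) k) x =
      (\<Sum>j<length es. if j = k then of_bool (x = snd (es ! k)) - of_bool (x = fst (es ! k)) else 0)"
    unfolding boundary_def using assms by (intro sum.cong) auto
  then show ?thesis using assms by simp
qed

text \<open>Loop-freeness makes the two encodings agree: a loop would have the entry -1 in
  \<open>incidence_mat\<close>, whereas its two contributions to \<open>boundary\<close>
  cancel.\<close>

lemma flow_lattice_iff: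
  assumes loopfree: "\<And>e. e \<in> set es \<Longrightarrow> fst e \<noteq> snd e"
  shows "f \<in> flow_lattice vs es \<longleftrightarrow>
    f \<in> carrier_vec (length es) \<and> (\<forall>x\<in>set vs. boundary es f x = 0)"
proof -
  have "(incidence_mat vs es *\<^sub>v map_vec real_of_int f) $ i = of_int (boundary es f (vs ! i))"
    if i: "i < length vs" and f: "f \<in> carrier_vec (length es)" for i
  proof -
    have "(incidence_mat vs es *\<^sub>v map_vec real_of_int f) $ i =
      (\<Sum>j<length es. (if vs ! i = fst (es ! j) then - 1 else if vs ! i = snd (es ! j) then 1 else 0)
        * real_of_int (f $ j))"
      using i f by (simp add: incidence_mat_def scalar_prod_def lessThan_atLeast0)
    also have "\<dots> = of_int (boundary es f (vs ! i))"
      unfolding boundary_def of_int_sum using loopfree[OF nth_mem]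
      by (intro sum.cong) auto
    finally show ?thesis .
  qed
  then have "incidence_mat vs es *\<^sub>v map_vec real_of_int f = 0\<^sub>v (length vs) \<longleftrightarrow>
      (\<forall>x\<in>set vs. boundary es f x = 0)" if "f \<in> carrier_vec (length es)"
    using that by (auto simp: vec_eq_iff incidence_mat_def all_set_conv_all_nth)
  then show ?thesis
    by (auto simp: flow_lattice_def mat_kernel_def incidence_mat_def)
qed

section \<open>Paths, cuts and the rank of the flow lattice\<close>

text \<open>A path from \<open>x\<close> to \<open>y\<close> through the first \<open>k\<close> edges, encoded by the integral chain that it
  carries.\<close>

definition linked :: "('v \<times> 'v) list \<Rightarrow> nat \<Rightarrow> 'v \<Rightarrow> 'v \<Rightarrow> bool" where
  "linked es k x y \<longleftrightarrow> (\<exists>p\<in>carrier_vec (length es). (\<forall>j. k \<le> j \<and> j < length es \<longrightarrow> p $ j = 0) \<and>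
     (\<forall>z. boundary es p z = of_bool (z = y) - of_bool (z = x)))"

lemma linked_refl: "linked es k x x"
  unfolding linked_def by (rule bexI[of _ "0\<^sub>v (length es)"]) (auto simp: boundary_zero)

lemma linked_sym:
  assumes "linked es k x y"
  shows "linked es k y x"
proof -
  obtain p where "p \<in> carrier_vec (length es)" "\<forall>j. k \<le> j \<and> j < length es \<longrightarrow> p $ j = 0"
    "\<forall>z. boundary es p z = of_bool (z = y) - of_bool (z = x)"
    using assms unfolding linked_def by blast
  then show ?thesis
    unfolding linked_def by (intro bexI[of _ "- 1 \<cdot>\<^sub>v p"]) (auto simp: boundary_smult)
qed

lemma linked_trans:
  assumes "linked es k x y" "linked es k y z"
  shows "linked es k x z"
proof -
  obtain p q where "p \<in> carrier_vec (length es)" "\<forall>j. k \<le> j \<and> j < length es \<longrightarrow> p $ j = 0"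
    "\<forall>z. boundary es p z = of_bool (z = y) - of_bool (z = x)"
    "q \<in> carrier_vec (length es)" "\<forall>j. k \<le> j \<and> j < length es \<longrightarrow> q $ j = 0"
    "\<forall>w. boundary es q w = of_bool (w = z) - of_bool (w = y)"
    using assms unfolding linked_def by blast
  then show ?thesis
    unfolding linked_def by (intro bexI[of _ "p + q"]) (auto simp: boundary_add)
qed

lemma linked_mono: "linked es k x y \<Longrightarrow> k \<le> l \<Longrightarrow> linked es l x y"
  unfolding linked_def by (meson le_trans)

lemma linked_edge:
  assumes "k < length es"
  shows "linked es (Suc k) (fst (es ! k)) (snd (es ! k))"
  unfolding linked_def
  using assms by (intro bexI[of _ "unit_vec (length es) k"]) (auto simp: boundary_unit)

text \<open>The chain linking the ends of edge \<open>k\<close>, reversed and closed up by that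
  edge, is a cycle whose last nonzero coordinate is \<open>k\<close>.\<close>

lemma pivot_flowI:
  assumes loopfree: "\<And>e. e \<in> set es \<Longrightarrow> fst e \<noteq> snd e"
    and k: "k < length es" and linked: "linked es k (fst (es ! k)) (snd (es ! k))"
  shows "k \<in> pivots (length es) (flow_lattice vs es)"
proof -
  obtain p where p: "p \<in> carrier_vec (length es)" "\<forall>j. k \<le> j \<and> j < length es \<longrightarrow> p $ j = 0"
    "\<forall>z. boundary es p z = of_bool (z = fst (es ! k)) - of_bool (z = snd (es ! k))"
    using linked_sym[OF linked] unfolding linked_def by blast
  let ?f = "p + unit_vec (length es) k"
  have "?f \<in> flow_lattice vs es"
    using p k by (simp add: flow_lattice_iff[OF loopfree] boundary_add boundary_unit)
  moreover have "?f $ k \<noteq> 0" "\<forall>i. k < i \<and> i < length es \<longrightarrow> ?f $ i = 0"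
    using p k by auto
  ultimately show ?thesis unfolding pivots_def using k by blast
qed

text \<open>The boundary of a flow summed over \<open>S\<close> is the net flow across a cut. Edges
  before \<open>k\<close> do not cross it, and edges after \<open>k\<close> carry nothing in a flow
  that witnesses a pivot at \<open>k\<close>, so the value on edge \<open>k\<close> itself would
  have to be zero.\<close>

lemma not_pivot_flowI:
  assumes edges: "\<And>e. e \<in> set es \<Longrightarrow> fst e \<in> set vs \<and> snd e \<in> set vs \<and> fst e \<noteq> snd e"
    and k: "k < length es"
    and cut: "\<And>j. j < k \<Longrightarrow> fst (es ! j) \<in> S \<longleftrightarrow> snd (es ! j) \<in> S"
    and "fst (es ! k) \<in> S" "snd (es ! k) \<notin> S"
  shows "k \<notin> pivots (length es) (flow_lattice vs es)"
proof
  assume "k \<in> pivots (length es) (flow_lattice vs es)"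
  then obtain f where f: "f \<in> flow_lattice vs es" "f $ k \<noteq> 0"
    "\<And>i. k < i \<Longrightarrow> i < length es \<Longrightarrow> f $ i = 0" by (auto simp: pivots_def)
  \<comment> \<open>The intersection is finite, and only on \<open>set vs\<close> is the boundary
    known to vanish. All ends of edges lie in \<open>set vs\<close>, so membership in
    \<open>S\<close> is unchanged for them.\<close>
  let ?S = "S \<inter> set vs"
  have "0 = (\<Sum>x\<in>?S. boundary es f x)"
    using f(1) edges by (subst (asm) flow_lattice_iff) auto
  also have "\<dots> = (\<Sum>j<length es. \<Sum>x\<in>?S.
      f $ j * (of_bool (x = snd (es ! j)) - of_bool (x = fst (es ! j))))"
    unfolding boundary_def by (rule sum.swap)
  also have "\<dots> = (\<Sum>j<length es.
      f $ j * (of_bool (snd (es ! j) \<in> S) - of_bool (fst (es ! j) \<in> S)))"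
  proof (rule sum.cong)
    fix j assume "j \<in> {..<length es}"
    then have "fst (es ! j) \<in> set vs" "snd (es ! j) \<in> set vs" using edges[OF nth_mem] by auto
    then show "(\<Sum>x\<in>?S. f $ j * (of_bool (x = snd (es ! j)) - of_bool (x = fst (es ! j)))) =
        f $ j * (of_bool (snd (es ! j) \<in> S) - of_bool (fst (es ! j) \<in> S))"
      by (simp add: of_bool_def sum_subtractf flip: sum_distrib_left)
  qed simp
  also have "\<dots> = (\<Sum>j<length es. if j = k then - f $ k else 0)"
    using cut f(3) assms(4,5)
    by (intro sum.cong) (auto simp: not_less_iff_gr_or_eq dest: linorder_neqE_nat)
  also have "\<dots> = - f $ k" using k by simp
  finally show False using f(2) by simp
qed

text \<open>The fibres of \<open>c\<close> are the components of the graph formed by the first \<open>k\<close> edges: an edge is a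
  pivot if it closes a cycle, and otherwise it merges two components.\<close>

lemma card_nonpivots_add_classes:
  assumes edges: "\<And>e. e \<in> set es \<Longrightarrow> fst e \<in> set vs \<and> snd e \<in> set vs \<and> fst e \<noteq> snd e"
    and "k \<le> length es"
  shows "\<exists>c::'v \<Rightarrow> 'v. (\<forall>j<k. c (fst (es ! j)) = c (snd (es ! j))) \<and>
    (\<forall>x y. c x = c y \<longrightarrow> linked es k x y) \<and>
    card {j. j < k \<and> j \<notin> pivots (length es) (flow_lattice vs es)} + card (c ` set vs) =
      card (set vs)"
  using assms(2)
proof (induction k)
  case 0
  \<comment> \<open>Without edges every vertex is its own component, so the identity serves as
    labelling and there are no nonpivots to count.\<close>
  show ?case by (rule exI[of _ "\<lambda>x. x"]) (auto simp: linked_refl)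
next
  case (Suc k)
  let ?P = "pivots (length es) (flow_lattice vs es)"
  obtain c :: "'v \<Rightarrow> 'v" where c: "\<And>j. j < k \<Longrightarrow> c (fst (es ! j)) = c (snd (es ! j))"
    "\<And>x y. c x = c y \<Longrightarrow> linked es k x y"
    "card {j. j < k \<and> j \<notin> ?P} + card (c ` set vs) = card (set vs)"
    using Suc by auto
  have k: "k < length es" using Suc.prems by simp
  define u v where "u = fst (es ! k)" and "v = snd (es ! k)"
  have uv: "u \<in> set vs" "v \<in> set vs" using edges[OF nth_mem[OF k]] by (auto simp: u_def v_def)
  have mono: "linked es (Suc k) x y" if "c x = c y" for x y
    using linked_mono[OF c(2)[OF that]] by simp
  show ?case
  proof (cases "c u = c v")
    case True
    then have "k \<in> ?P" using c(2) k edges by (intro pivot_flowI) (auto simp: u_def v_def)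
    then have "{j. j < Suc k \<and> j \<notin> ?P} = {j. j < k \<and> j \<notin> ?P}" by (auto simp: less_Suc_eq)
    then show ?thesis
      using c True mono by (intro exI[of _ c]) (auto simp: less_Suc_eq u_def v_def)
  next
    case False
    \<comment> \<open>The component of \<open>u\<close> takes over the label of \<open>v\<close>.
      The label \<open>c u\<close> leaves the image, so the number of classes drops by one just as
      edge \<open>k\<close> joins the nonpivots.\<close>
    define d where "d x = (if c x = c u then c v else c x)" for x
    \<comment> \<open>The cut is the fibre of \<open>u\<close>, which no earlier edge leaves because
      \<open>c\<close> agrees on the ends of those edges.\<close>
    have "k \<notin> ?P"
      using False c(1) by (intro not_pivot_flowI[OF edges k, where S = "{x. c x = c u}"])
        (auto simp: u_def v_def)
    then have "{j. j < Suc k \<and> j \<notin> ?P} = insert k {j. j < k \<and> j \<notin> ?P}"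
      by (auto simp: less_Suc_eq)
    moreover have "c ` set vs = insert (c u) (d ` set vs)" "c u \<notin> d ` set vs"
      using uv False by (auto simp: d_def image_iff split: if_splits)
    ultimately have "card {j. j < Suc k \<and> j \<notin> ?P} + card (d ` set vs) = card (set vs)"
      using c(3) by simp
    moreover have "linked es (Suc k) x y" if "d x = d y" for x y
    proof -
      have "linked es (Suc k) u v" using linked_edge[OF k] by (simp add: u_def v_def)
      then show ?thesis
        using that mono by (auto simp: d_def split: if_splits) (metis linked_trans linked_sym)+
    qed
    moreover have "d (fst (es ! j)) = d (snd (es ! j))" if "j < Suc k" for j
      using that c(1) by (auto simp: d_def less_Suc_eq u_def v_def)
    ultimately show ?thesis by blast
  qed
qed

text \<open>With all edges present there is exactly one component, so the nonpivots number one less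
  than the vertices, like the edges of a spanning tree; the pivots are the remaining edges.\<close>

lemma card_pivots_flow_lattice:
  assumes edges: "\<And>e. e \<in> set es \<Longrightarrow> fst e \<in> set vs \<and> snd e \<in> set vs \<and> fst e \<noteq> snd e"
    and "vs \<noteq> []"
    and connected: "\<And>x y. x \<in> set vs \<Longrightarrow> y \<in> set vs \<Longrightarrow> (x, y) \<in> (set es \<union> (set es)\<inverse>)\<^sup>*"
  shows "card (pivots (length es) (flow_lattice vs es)) + card (set vs) = length es + 1"
proof -
  let ?P = "pivots (length es) (flow_lattice vs es)"
  obtain c :: "'a \<Rightarrow> 'a" where c: "\<And>j. j < length es \<Longrightarrow> c (fst (es ! j)) = c (snd (es ! j))"
    "card {j. j < length es \<and> j \<notin> ?P} + card (c ` set vs) = card (set vs)"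
    using card_nonpivots_add_classes[of es vs "length es"] edges by blast
  have const: "c x = c y" if "(x, y) \<in> (set es \<union> (set es)\<inverse>)\<^sup>*" for x y
    using that
  proof induction
    case (step y z)
    then show ?case using c(1) by (auto simp: in_set_conv_nth) (metis fst_conv snd_conv)+
  qed simp
  obtain x where x: "x \<in> set vs" using \<open>vs \<noteq> []\<close> by (meson last_in_set)
  then have "c ` set vs = {c x}" using const connected by blast
  moreover have "card {j. j < length es \<and> j \<notin> ?P} + card ?P = length es"
  proof -
    have "{..<length es} = {j. j < length es \<and> j \<notin> ?P} \<union> ?P" by (auto simp: pivots_def)
    moreover have "finite ?P" by (rule finite_subset[of _ "{..<length es}"]) (auto simp: pivots_def)
    ultimately show ?thesis
      using card_Un_disjoint[of "{j. j < length es \<and> j \<notin> ?P}" ?P]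
      by (metis (no_types, lifting) card_lessThan disjoint_iff finite_Un finite_lessThan mem_Collect_eq)
  qed
  ultimately show ?thesis using c(2) by simp
qed


section \<open>Flow lattices of connected graphs\<close>

theorem corollary3p13:
  fixes G :: "'v pair_pre_digraph"
    and vs :: "'v list" and es :: "('v \<times> 'v) list"
  assumes "pair_graph G" and "Digraph_Component.connected (with_proj G)"
    and "distinct vs" and "set vs = pverts G"
    and "distinct es" and "orientation G (set es)"
  shows "\<exists>fs. int (length fs) = int (length es) - int (length vs) + 1 \<and>
              integral_flow_M_basis vs es fs"
proof -
  interpret pair_graph G by fact
  let ?L = "flow_lattice vs es" and ?m = "length es"
  have edges: "fst e \<in> set vs \<and> snd e \<in> set vs \<and> fst e \<noteq> snd e" if "e \<in> set es" for e
    using that assms(4,6) arc_fst_in_verts arc_snd_in_verts pair_no_loops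
    by (auto simp: orientation_def)
  note flow = flow_lattice_iff[OF conjunct2[OF conjunct2[OF edges]]]
  obtain fs where fs: "Z_basis ?m ?L fs"
    "\<forall>f\<in>set fs. \<forall>g\<in>set fs. f \<noteq> g \<longrightarrow> f \<bullet> g \<le> 0"
    "length fs = card (pivots ?m ?L)"
  proof -
    have "?L \<subseteq> carrier_vec ?m" using flow by blast
    then show ?thesis
      using ex_obtuse_Z_basis[of ?L ?m] that
      by (auto simp: flow boundary_zero boundary_add boundary_smult)
  qed
  \<comment> \<open>Connectedness refers to the symmetric closure, while \<open>es\<close> holds
    each edge in one direction only; adding the converse recovers all arcs.\<close>
  have sub: "parcs (mk_symmetric (with_proj G)) \<subseteq> set es \<union> (set es)\<inverse>"
  proof -
    have "(x, y) \<in> set es \<union> (set es)\<inverse>" if "(x, y) \<in> parcs G" for x y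
      using that assms(6) by (auto simp: orientation_def)
    then show ?thesis by (force simp: parcs_mk_symmetric)
  qed
  \<comment> \<open>Strong connectedness includes having a vertex. This excludes the empty graph,
    for which the rank formula would give 1 instead of 0.\<close>
  have "pverts G \<noteq> {}"
    using assms(2) by (auto simp: connected_def strongly_connected_def)
  have reach: "x \<rightarrow>\<^sup>*\<^bsub>with_proj (mk_symmetric (with_proj G))\<^esub> y"
    if "x \<in> pverts G" "y \<in> pverts G" for x y
    using assms(2) that by (auto simp: connected_def strongly_connected_def)
  have "(x, y) \<in> (set es \<union> (set es)\<inverse>)\<^sup>*" if "x \<in> set vs" "y \<in> set vs" for x y
  proof -
    have "(x, y) \<in> (parcs (mk_symmetric (with_proj G)))\<^sup>*"
      using reachable_rtranclI[OF reach[of x y]] that assms(4) by simp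
    then show ?thesis using rtrancl_mono[OF sub] by blast
  qed
  moreover have "vs \<noteq> []" using \<open>pverts G \<noteq> {}\<close> assms(4) by auto
  ultimately have "card (pivots ?m ?L) + card (set vs) = ?m + 1"
    using card_pivots_flow_lattice[of es vs] edges by blast
  then have "int (length fs) = int ?m - int (length vs) + 1"
    using fs(3) distinct_card[OF \<open>distinct vs\<close>] by linarith
  moreover have "integral_flow_M_basis vs es fs"
    unfolding integral_flow_M_basis_def using fs(1,2) Z_basis_imp_M_matrix[OF fs(1)] by blast
  ultimately show ?thesis by blast
qed

end
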